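(* Let $d\ge 2$ be fixed. Then for every norm $\|\cdot\|$ on $\mathbb{R}^d$ we have $U_{\|\cdot\|}(n)\ge \frac{d-1-o(1)}{2}\cdot n\log_2 n$, where the $o(1)$-term tends to zero as $n\to\infty$. That is, for every norm $\|\cdot\|$ on $\mathbb{R}^d$ and every $\varepsilon>0$ there exists $n_0$ such that for every $n\ge n_0$ there is a set of $n$ points in $\mathbb{R}^d$ such that the number of unordered pairs of these points at distance exactly $1$ according to $\|\cdot\|$ is at least $\frac{d-1-\varepsilon}{2}\cdot n\log_2 n$.
   Context: For a norm $\|\cdot\|$ on $\mathbb{R}^d$, $U_{\|\cdot\|}(n)$ denotes the maximum, over all sets of $n$ distinct points in $\mathbb{R}^d$, of the number of unordered pairs of these points at distance exactly $1$ according to $\|\cdot\|$. *)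

theory Defs
  imports "HOL-Analysis.Analysis"
begin

text \<open>A norm on a real vector space as a predicate on functions: the class constant
  \<^term>\<open>norm\<close> on \<^typ>\<open>real ^ 'd\<close> is the Euclidean norm only.\<close>

definition is_norm :: "('v::real_vector \<Rightarrow> real) \<Rightarrow> bool" where
  "is_norm N \<longleftrightarrow>
     (\<forall>x. 0 \<le> N x) \<and>
     (\<forall>x. N x = 0 \<longleftrightarrow> x = 0) \<and>
     (\<forall>c x. N (c *\<^sub>R x) = \<bar>c\<bar> * N x) \<and>
     (\<forall>x y. N (x + y) \<le> N x + N y)"

definition unit_pairs :: "('v::real_vector \<Rightarrow> real) \<Rightarrow> 'v set \<Rightarrow> 'v set set" where
  "unit_pairs N P = {{x, y} | x y. x \<in> P \<and> y \<in> P \<and> x \<noteq> y \<and> N (x - y) = 1}"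

definition max_unit_distances :: "('v::real_vector \<Rightarrow> real) \<Rightarrow> nat \<Rightarrow> nat" where
  "max_unit_distances N n = Max {card (unit_pairs N P) | P. finite P \<and> card P = n}"

text \<open>The set under \<^term>\<open>Max\<close> is finite and nonempty, so the maximum is a genuine one.\<close>

lemma finite_unit_pair_counts:
  fixes N :: "'v::real_vector \<Rightarrow> real"
  shows "finite {card (unit_pairs N P) | P. finite P \<and> card P = n}"
proof (rule finite_subset)
  show "{card (unit_pairs N P) | P. finite P \<and> card P = n} \<subseteq> {..2 ^ n}"
  proof clarsimp
    fix P :: "'v set"
    assume "finite P" "n = card P"
    moreover have "unit_pairs N P \<subseteq> Pow P"
      by (auto simp: unit_pairs_def)
    ultimately show "card (unit_pairs N P) \<le> 2 ^ card P"
      by (metis card_Pow card_mono finite_Pow_iff)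
  qed
qed simp

lemma unit_pair_counts_nonempty:
  fixes N :: "real ^ 'd \<Rightarrow> real"
  shows "{card (unit_pairs N P) | P. finite P \<and> card P = n} \<noteq> {}"
proof -
  have "infinite (UNIV :: (real ^ 'd) set)"
    using not_bounded_UNIV finite_imp_bounded by blast
  then obtain P :: "(real ^ 'd) set" where "finite P" "card P = n"
    using infinite_arbitrarily_large by blast
  then show ?thesis by blast
qed

end

theory Submission
  imports Defs "HOL-Real_Asymp.Real_Asymp"
begin

text \<open>
  Let \<open>d\<close> be the dimension. Everything rests on a set \<open>B\<close> of \<open>d - 1\<close> vectors for which infinitely many
  vectors \<open>v\<close> satisfy \<open>N (v + b) = 1\<close> for all \<open>b \<in> B\<close>. Given such a \<open>B\<close>, replace a finite set \<open>A\<close> by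
  the union of \<open>A\<close> and \<open>A + v\<close>. This doubles the number of points, and \<open>{a, a + b + v}\<close> is a new unit pair
  whenever \<open>a\<close> and \<open>a + b\<close> lie in \<open>A\<close>. If \<open>A\<close> is almost invariant under translation by
  each \<open>b \<in> B\<close>, then each doubling creates almost \<open>(d - 1) * card A\<close> new pairs, and the doubled set
  is again almost invariant. After \<open>i\<close> doublings a set of \<open>n = 2 ^ i * m\<close> points has almost
  \<open>(d - 1) / 2 * i * n\<close> unit pairs, where \<open>i\<close> differs from \<open>log 2 n\<close> by the constant \<open>log 2 m\<close>
  (\<open>iterated_doubling\<close>). A starting set of some size \<open>m\<close> exists because
  the sums of elements of \<open>B\<close> with bounded coefficients grow only polynomially
  (\<open>exists_almost_invariant_set\<close>), and general \<open>n\<close> are reached by disjoint translates.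

  Geometry enters only through \<open>B\<close> (\<open>infinitely_many_common_translates\<close>). Its elements are unit vectors
  at which \<open>N\<close> is differentiable, with linearly independent gradients. The \<open>d - 1\<close> equations
  \<open>N (v + b) = 1\<close> then hold at \<open>v = 0\<close> with independent linearizations, and a topological open mapping
  theorem gives a solution \<open>v\<close> for each small value of the remaining coordinate. There are
  enough such unit vectors: a Euclidean ball that grows inside the unit ball of \<open>N\<close> touches the unit
  sphere at a point of differentiability, and with a center close to the sphere the gradient there
  can be made transversal to any prescribed direction (\<open>smooth_unit_vector_transversal\<close>).
\<close>

section \<open>Norms on Euclidean spaces\<close>

lemma is_norm_nonneg: "is_norm N \<Longrightarrow> 0 \<le> N x"
  and is_norm_zero: "is_norm N \<Longrightarrow> N 0 = 0"
  and is_norm_pos: "is_norm N \<Longrightarrow> x \<noteq> 0 \<Longrightarrow> 0 < N x"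
  and is_norm_scale: "is_norm N \<Longrightarrow> N (c *\<^sub>R x) = \<bar>c\<bar> * N x"
  and is_norm_triangle: "is_norm N \<Longrightarrow> N (x + y) \<le> N x + N y"
  unfolding is_norm_def by (auto simp: less_le)

lemma is_norm_minus: "is_norm N \<Longrightarrow> N (- x) = N x"
  using is_norm_scale[of N "-1" x] by simp

lemma is_norm_diff_le: "is_norm N \<Longrightarrow> \<bar>N x - N y\<bar> \<le> N (x - y)"
  using is_norm_triangle[of N "x - y" y] is_norm_triangle[of N "y - x" x] is_norm_minus[of N "x - y"]
  by simp

lemma is_norm_le_euclidean:
  fixes N :: "'a::euclidean_space \<Rightarrow> real"
  assumes "is_norm N"
  obtains C where "0 < C" "\<And>x. N x \<le> C * norm x"
proof
  let ?C = "1 + (\<Sum>b\<in>Basis. N b)"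
  show "0 < ?C"
    by (intro add_pos_nonneg sum_nonneg is_norm_nonneg[OF assms]) simp
  fix x
  have sum_le: "N (\<Sum>b\<in>S. (x \<bullet> b) *\<^sub>R b) \<le> (\<Sum>b\<in>S. \<bar>x \<bullet> b\<bar> * N b)" if "finite S" for S
    using that
  proof induction
    case (insert b S)
    then show ?case
      using is_norm_triangle[OF assms, of "(x \<bullet> b) *\<^sub>R b" "\<Sum>b\<in>S. (x \<bullet> b) *\<^sub>R b"]
      by (simp add: is_norm_scale[OF assms])
  qed (simp add: is_norm_zero[OF assms])
  have "N x \<le> (\<Sum>b\<in>Basis. \<bar>x \<bullet> b\<bar> * N b)"
    using sum_le[of Basis] by (simp add: euclidean_representation)
  also have "\<dots> \<le> (\<Sum>b\<in>Basis. norm x * N b)"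
    by (intro sum_mono mult_right_mono is_norm_nonneg[OF assms] Basis_le_norm)
  also have "\<dots> \<le> ?C * norm x"
    by (simp add: sum_distrib_left[symmetric] mult.commute[of _ "norm x"] distrib_left)
  finally show "N x \<le> ?C * norm x" .
qed

lemma continuous_on_is_norm:
  fixes N :: "'a::euclidean_space \<Rightarrow> real"
  assumes "is_norm N"
  shows "continuous_on S N"
proof -
  obtain C where C: "0 < C" "\<And>x. N x \<le> C * norm x"
    using is_norm_le_euclidean[OF assms] by blast
  have "C-lipschitz_on S N"
    using C is_norm_diff_le[OF assms]
    by (intro lipschitz_onI) (auto simp: dist_norm intro: order_trans)
  then show ?thesis by (rule lipschitz_on_continuous_on)
qed

section \<open>Smooth points of the unit sphere\<close>

text \<open>A Euclidean ball inside the unit ball of \<^term>\<open>N\<close> that touches the unit sphere at \<^term>\<open>p\<close>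
  fixes the supporting hyperplane there, with normal \<^term>\<open>p - c\<close>: from a point of the unit ball strictly
  beyond that hyperplane, the segment through \<^term>\<open>p\<close> continues into the open Euclidean ball, which
  makes \<^term>\<open>p\<close> a proper convex combination with \<^term>\<open>N p < 1\<close>.\<close>

lemma touching_ball_supports:
  fixes N :: "'a::euclidean_space \<Rightarrow> real"
  assumes N: "is_norm N" and p: "N p = 1" and "p \<noteq> c"
    and ball: "\<And>y. dist c y < dist c p \<Longrightarrow> N y < 1"
  defines "n \<equiv> p - c"
  shows "0 < n \<bullet> p" "n \<bullet> x \<le> (n \<bullet> p) * N x"
proof -
  have halfspace: "n \<bullet> x \<le> n \<bullet> p" if x: "N x \<le> 1" for x
  proof (rule ccontr)
    assume outside: "\<not> ?thesis"
    define v where "v = x - p"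
    have nv: "0 < n \<bullet> v" using outside by (simp add: v_def inner_diff_right)
    then have v: "0 < v \<bullet> v" by auto
    \<comment> \<open>This \<open>\<tau>\<close> minimizes the Euclidean distance of \<open>p - \<tau> *\<^sub>R v\<close> from \<open>c\<close>.\<close>
    define \<tau> where "\<tau> = (n \<bullet> v) / (v \<bullet> v)"
    have \<tau>: "0 < \<tau>" using nv v by (simp add: \<tau>_def)
    define y where "y = p - \<tau> *\<^sub>R v"
    have "(y - c) \<bullet> (y - c) = n \<bullet> n - 2 * \<tau> * (n \<bullet> v) + \<tau> * (\<tau> * (v \<bullet> v))"
      by (simp add: y_def n_def algebra_simps inner_commute)
    also have "\<tau> * (v \<bullet> v) = n \<bullet> v"
      using v by (simp add: \<tau>_def)
    finally have "(y - c) \<bullet> (y - c) < n \<bullet> n"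
      using nv \<tau> by simp
    then have "dist c y < dist c p"
      by (simp add: dist_norm n_def norm_minus_commute[of c] norm_lt)
    then have y1: "N y < 1" by (rule ball)
    have "(1 + \<tau>) *\<^sub>R p = y + \<tau> *\<^sub>R x"
      by (simp add: y_def v_def algebra_simps)
    then have "N ((1 + \<tau>) *\<^sub>R p) \<le> N y + N (\<tau> *\<^sub>R x)"
      using is_norm_triangle[OF N, of y "\<tau> *\<^sub>R x"] by simp
    then have "(1 + \<tau>) * N p \<le> N y + \<tau> * N x"
      using \<tau> by (simp add: is_norm_scale[OF N])
    also have "\<dots> < 1 + \<tau>"
      using mult_left_mono[OF x less_imp_le[OF \<tau>]] by (intro add_less_le_mono y1) simp
    finally show False using p by simp
  qed
  have n0: "n \<noteq> 0" using \<open>p \<noteq> c\<close> by (simp add: n_def)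
  have "N (inverse (N n) *\<^sub>R n) \<le> 1"
    using is_norm_pos[OF N n0] by (simp add: is_norm_scale[OF N])
  from halfspace[OF this] show "0 < n \<bullet> p"
    using is_norm_pos[OF N n0] n0
    by (smt (verit) inner_scaleR_right inner_gt_zero_iff mult_pos_pos positive_imp_inverse_positive)
  show "n \<bullet> x \<le> (n \<bullet> p) * N x"
  proof (cases "x = 0")
    case False
    have "N (inverse (N x) *\<^sub>R x) \<le> 1"
      using is_norm_pos[OF N False] by (simp add: is_norm_scale[OF N])
    from halfspace[OF this] show ?thesis
      using is_norm_pos[OF N False] by (simp add: field_simps)
  qed (simp add: is_norm_zero[OF N])
qed

text \<open>At a touching point the supporting functional bounds \<^term>\<open>N\<close> from below, and the Euclidean ball,
  which is round, bounds it from above with a quadratic error. So \<^term>\<open>N\<close> is differentiable there.\<close>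

lemma touching_ball_differentiable:
  fixes N :: "'a::euclidean_space \<Rightarrow> real"
  assumes N: "is_norm N" and p: "N p = 1" and "p \<noteq> c"
    and ball: "\<And>y. dist c y < dist c p \<Longrightarrow> N y < 1"
    and cball: "\<And>y. dist c y \<le> dist c p \<Longrightarrow> N y \<le> 1"
  defines "a \<equiv> inverse ((p - c) \<bullet> p) *\<^sub>R (p - c)"
  shows "a \<bullet> p = 1" "a \<bullet> x \<le> N x" "(N has_derivative (\<lambda>h. a \<bullet> h)) (at p)"
proof -
  define n where "n = p - c"
  note supp = touching_ball_supports[OF N p \<open>p \<noteq> c\<close> ball, folded n_def]
  have a: "a = inverse (n \<bullet> p) *\<^sub>R n" by (simp add: a_def n_def)
  show ap: "a \<bullet> p = 1" using supp(1) by (simp add: a)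
  show aN: "a \<bullet> x \<le> N x" for x
    using supp(1) supp(2)[of x] by (simp add: a field_simps)
  define r2 where "r2 = n \<bullet> n"
  have r2: "0 < r2" using \<open>p \<noteq> c\<close> by (simp add: r2_def n_def)
  \<comment> \<open>A tangent step by \<open>w\<close> leaves the ball, but moving back by \<open>\<epsilon> *\<^sub>R n\<close>, with \<open>\<epsilon>\<close> quadratic in \<open>w\<close>, re-enters it.\<close>
  have tangent: "N (p + w) \<le> 1 + (w \<bullet> w) / r2 * N n" if w: "a \<bullet> w = 0" "w \<bullet> w \<le> r2" for w
  proof -
    define \<epsilon> where "\<epsilon> = (w \<bullet> w) / r2"
    have \<epsilon>: "0 \<le> \<epsilon>" "\<epsilon> \<le> 1" "\<epsilon> * r2 = w \<bullet> w"
      using w r2 by (auto simp: \<epsilon>_def)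
    have nw: "n \<bullet> w = 0" using w(1) supp(1) by (simp add: a)
    define y where "y = p + w - \<epsilon> *\<^sub>R n"
    have yc: "y - c = n + w - \<epsilon> *\<^sub>R n" by (simp add: y_def n_def)
    have "(y - c) \<bullet> (y - c) = r2 - 2 * (\<epsilon> * r2) + \<epsilon> * (\<epsilon> * r2) + w \<bullet> w"
      unfolding yc using nw by (simp add: r2_def inner_commute[of w n] algebra_simps)
    also have "\<dots> \<le> r2"
      using \<epsilon> mult_right_mono[OF \<epsilon>(2), of "w \<bullet> w"] by simp
    finally have "dist c y \<le> dist c p"
      by (simp add: dist_norm r2_def n_def norm_minus_commute[of c] norm_le)
    then have "N y \<le> 1" by (rule cball)
    moreover have "p + w = y + \<epsilon> *\<^sub>R n" by (simp add: y_def)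
    ultimately show ?thesis
      using is_norm_triangle[OF N, of y "\<epsilon> *\<^sub>R n"] \<epsilon>
      by (simp add: is_norm_scale[OF N] flip: \<epsilon>_def)
  qed
  define K where "K = 1 + norm a * norm p"
  define C where "C = 1 + 8 * K^2 * N n / r2"
  have K: "1 \<le> K" by (simp add: K_def)
  have C: "0 < C" using r2 is_norm_nonneg[OF N, of n] by (simp add: C_def add_pos_nonneg)
  \<comment> \<open>The two bounds keep \<open>\<bar>a \<bullet> h\<bar>\<close> below 1/2 and the tangent part of \<open>h\<close> within the radius of the ball.\<close>
  define \<rho> where "\<rho> = min (1 / (2 * (1 + norm a))) (sqrt r2 / (2 * K))"
  have \<rho>: "0 < \<rho>" using r2 K by (auto simp: \<rho>_def add_pos_nonneg)
  have quadratic: "\<bar>N (p + h) - 1 - a \<bullet> h\<bar> \<le> C * (norm h)^2" if h: "norm h < \<rho>" for h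
  proof -
    define \<beta> where "\<beta> = a \<bullet> h"
    have "\<bar>\<beta>\<bar> \<le> norm a * norm h" by (simp add: \<beta>_def Cauchy_Schwarz_ineq2)
    also have "\<dots> \<le> (1 + norm a) * norm h" by (simp add: mult_right_mono)
    also have "\<dots> \<le> (1 + norm a) * (1 / (2 * (1 + norm a)))"
      using h by (intro mult_left_mono) (auto simp: \<rho>_def)
    also have "\<dots> = 1/2" by (simp add: add_pos_nonneg field_simps) (smt (verit) norm_ge_zero)
    finally have \<beta>: "\<bar>\<beta>\<bar> \<le> 1/2" .
    \<comment> \<open>Homogeneity reduces a general increment to a tangent one.\<close>
    define w where "w = inverse (1 + \<beta>) *\<^sub>R (h - \<beta> *\<^sub>R p)"
    have aw: "a \<bullet> w = 0" by (simp add: w_def inner_diff_right ap \<beta>_def)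
    have "(1 + \<beta>) *\<^sub>R w = h - \<beta> *\<^sub>R p"
      using \<beta> by (simp add: w_def)
    then have sc: "p + h = (1 + \<beta>) *\<^sub>R (p + w)"
      by (simp add: scaleR_add_right scaleR_add_left)
    have "norm (h - \<beta> *\<^sub>R p) \<le> norm h + \<bar>\<beta>\<bar> * norm p"
      using norm_triangle_ineq4[of h "\<beta> *\<^sub>R p"] by simp
    also have "\<dots> \<le> K * norm h"
      using mult_right_mono[OF \<open>\<bar>\<beta>\<bar> \<le> norm a * norm h\<close>, of "norm p"]
      by (simp add: K_def algebra_simps)
    finally have "norm (h - \<beta> *\<^sub>R p) \<le> K * norm h" .
    moreover have "inverse (1 + \<beta>) \<le> 2" "0 \<le> inverse (1 + \<beta>)"
      using \<beta> by (auto simp: field_simps)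
    ultimately have "norm w \<le> 2 * (K * norm h)"
      using \<beta> unfolding w_def norm_scaleR by (intro mult_mono) auto
    then have w: "norm w \<le> 2 * K * norm h" by simp
    also have "\<dots> \<le> 2 * K * (sqrt r2 / (2 * K))"
      using h K by (intro mult_left_mono) (auto simp: \<rho>_def)
    also have "\<dots> = sqrt r2" using K by simp
    finally have "w \<bullet> w \<le> r2"
      using r2 by (simp add: norm_eq_sqrt_inner)
    then have "N (p + w) \<le> 1 + (w \<bullet> w) / r2 * N n" by (rule tangent[OF aw])
    then have "N (p + h) \<le> (1 + \<beta>) * (1 + (w \<bullet> w) / r2 * N n)"
      using \<beta> unfolding sc is_norm_scale[OF N] by (intro mult_mono is_norm_nonneg[OF N]) auto
    also have "\<dots> = 1 + \<beta> + (1 + \<beta>) * ((w \<bullet> w) / r2 * N n)"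
      by (simp add: algebra_simps)
    also have "\<dots> \<le> 1 + \<beta> + 2 * ((w \<bullet> w) / r2 * N n)"
      using \<beta> r2 is_norm_nonneg[OF N, of n] by (intro add_left_mono mult_right_mono) auto
    also have "w \<bullet> w \<le> 4 * K^2 * (norm h)^2"
      using power_mono[OF w, of 2] by (simp add: power2_norm_eq_inner power_mult_distrib)
    finally have "N (p + h) \<le> 1 + \<beta> + 2 * (4 * K^2 * (norm h)^2 / r2 * N n)"
      using r2 is_norm_nonneg[OF N, of n]
      by (simp add: divide_right_mono mult_right_mono)
    also have "\<dots> \<le> 1 + \<beta> + C * (norm h)^2"
      by (simp add: C_def algebra_simps)
    finally have "N (p + h) - 1 - \<beta> \<le> C * (norm h)^2" by simp
    moreover have "1 + \<beta> \<le> N (p + h)"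
      using aN[of "p + h"] by (simp add: inner_add_right ap \<beta>_def)
    ultimately show ?thesis by (simp add: \<beta>_def)
  qed
  show "(N has_derivative (\<lambda>h. a \<bullet> h)) (at p)"
    unfolding has_derivative_at_alt
  proof (intro conjI allI impI)
    show "bounded_linear (\<lambda>h. a \<bullet> h)" by (rule bounded_linear_inner_right)
    fix e :: real assume e: "0 < e"
    show "\<exists>d>0. \<forall>y. norm (y - p) < d \<longrightarrow> norm (N y - N p - a \<bullet> (y - p)) \<le> e * norm (y - p)"
    proof (intro exI[of _ "min \<rho> (e / C)"] conjI allI impI)
      show "0 < min \<rho> (e / C)" using \<rho> e C by simp
      fix y assume y: "norm (y - p) < min \<rho> (e / C)"
      then have "\<bar>N y - 1 - a \<bullet> (y - p)\<bar> \<le> C * norm (y - p) * norm (y - p)"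
        using quadratic[of "y - p"] by (simp add: power2_eq_square)
      also have "\<dots> \<le> e * norm (y - p)"
        using y C by (intro mult_right_mono) (auto simp: field_simps)
      finally show "norm (N y - N p - a \<bullet> (y - p)) \<le> e * norm (y - p)" by (simp add: p)
    qed
  qed
qed

text \<open>Touching points arise as nearest points: blow up a ball around a center just below the point \<open>q\<close>
  of the unit sphere on the ray through \<^term>\<open>u\<close>, until it touches the sphere at some \<^term>\<open>p\<close>. Then
  \<^term>\<open>p\<close> is close to \<open>q\<close>, and the supporting functional, which is 1 at \<^term>\<open>p\<close> and bounded by
  \<^term>\<open>N\<close>, cannot vanish at \<open>q\<close>. Hence the gradients of \<^term>\<open>N\<close> span the
  whole space.\<close>

lemma smooth_unit_vector_transversal:
  fixes N :: "'a::euclidean_space \<Rightarrow> real"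
  assumes N: "is_norm N" and "u \<noteq> 0"
  obtains p a where "N p = 1" "(N has_derivative (\<lambda>h. a \<bullet> h)) (at p)" "a \<bullet> u \<noteq> 0"
proof -
  obtain C where C: "0 < C" "\<And>x. N x \<le> C * norm x"
    using is_norm_le_euclidean[OF N] by blast
  define q where "q = inverse (N u) *\<^sub>R u"
  have Nu: "0 < N u" by (rule is_norm_pos[OF N \<open>u \<noteq> 0\<close>])
  have Nq: "N q = 1" using Nu by (simp add: q_def is_norm_scale[OF N])
  have q0: "q \<noteq> 0" using Nq is_norm_zero[OF N] by auto
  \<comment> \<open>The choice of \<open>\<eta>\<close> forces \<open>N (p - q) < 1\<close>, as \<open>p\<close> is at least as close to \<open>c\<close> as \<open>q\<close> is.\<close>
  define \<eta> where "\<eta> = min 1 (1 / (4 * C * norm q))"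
  have \<eta>: "0 < \<eta>" "\<eta> \<le> 1" "2 * C * \<eta> * norm q < 1"
  proof -
    show "0 < \<eta>" "\<eta> \<le> 1" using C q0 by (auto simp: \<eta>_def)
    have "2 * C * norm q * \<eta> \<le> 2 * C * norm q * (1 / (4 * C * norm q))"
      using C by (intro mult_left_mono) (auto simp: \<eta>_def)
    also have "\<dots> = 1/2" using C q0 by simp
    finally show "2 * C * \<eta> * norm q < 1" by (simp add: mult_ac)
  qed
  define c where "c = (1 - \<eta>) *\<^sub>R q"
  have Nc: "N c < 1" using \<eta> Nq by (simp add: c_def is_norm_scale[OF N])
  have closed: "closed {x. 1 \<le> N x}" "closed {x. N x \<le> 1}"
    using continuous_on_is_norm[OF N, of UNIV] by (auto intro: closed_Collect_le)
  have qS: "q \<in> {x. 1 \<le> N x}" using Nq by simp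
  obtain p where pS: "p \<in> {x. 1 \<le> N x}" and "\<And>y. y \<in> {x. 1 \<le> N x} \<Longrightarrow> dist c p \<le> dist c y"
    using distance_attains_inf[OF closed(1), of c] qS by blast
  then have min: "dist c p \<le> dist c y" if "1 \<le> N y" for y using that by blast
  have pc: "p \<noteq> c" using pS Nc by auto
  have ball: "N y < 1" if "dist c y < dist c p" for y
    using min[of y] that by linarith
  have "ball c (dist c p) \<subseteq> {x. N x \<le> 1}"
    using ball by (auto intro: less_imp_le)
  then have "cball c (dist c p) \<subseteq> {x. N x \<le> 1}"
    using closure_minimal[OF _ closed(2)] pc by (metis closure_ball zero_less_dist_iff)
  then have cball: "N y \<le> 1" if "dist c y \<le> dist c p" for y
    using that by auto
  have p: "N p = 1" using pS cball[of p] by simp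
  define a where "a = inverse ((p - c) \<bullet> p) *\<^sub>R (p - c)"
  note touch = touching_ball_differentiable[OF N p pc ball cball, folded a_def]
  have "a \<bullet> u \<noteq> 0"
  proof
    assume "a \<bullet> u = 0"
    then have "a \<bullet> (p - q) = 1"
      using touch(1) by (simp add: q_def inner_diff_right)
    then have "1 \<le> N (p - q)" using touch(2)[of "p - q"] by simp
    also have "\<dots> \<le> C * dist p q" using C by (simp add: dist_norm)
    also have "\<dots> \<le> C * (2 * dist c q)"
      using min[of q] Nq C dist_triangle[of p q c] by (simp add: dist_commute)
    also have "dist c q = \<eta> * norm q"
      using \<eta> by (simp add: c_def dist_norm algebra_simps)
    finally show False using \<eta> by simp
  qed
  with p touch(3) show ?thesis by (rule that)
qed

text \<open>Gradients are collected one by one: each new one is transversal to a vector orthogonal to all the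
  previous ones.\<close>

lemma independent_smooth_family:
  fixes N :: "'a::euclidean_space \<Rightarrow> real"
  assumes N: "is_norm N" and "k \<le> DIM('a)"
  shows "\<exists>A. independent A \<and> card A = k \<and>
           (\<forall>a\<in>A. \<exists>p. N p = 1 \<and> (N has_derivative (\<lambda>h. a \<bullet> h)) (at p))"
  using \<open>k \<le> DIM('a)\<close>
proof (induction k)
  case 0
  show ?case by (intro exI[of _ "{}"]) (simp add: independent_empty)
next
  case (Suc k)
  then obtain A where A: "independent A" "card A = k"
    "\<forall>a\<in>A. \<exists>p. N p = 1 \<and> (N has_derivative (\<lambda>h. a \<bullet> h)) (at p)" by auto
  have "finite A" using A(1) by (rule independent_imp_finite)
  have "dim A < DIM('a)" using A Suc.prems by (simp add: dim_eq_card_independent)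
  then obtain u where "u \<noteq> 0" and orth: "\<And>y. y \<in> span A \<Longrightarrow> orthogonal u y"
    by (rule orthogonal_to_subspace_exists) blast
  obtain p a where pa: "N p = 1" "(N has_derivative (\<lambda>h. a \<bullet> h)) (at p)" "a \<bullet> u \<noteq> 0"
    using smooth_unit_vector_transversal[OF N \<open>u \<noteq> 0\<close>] .
  have "a \<notin> span A"
    using orth[of a] pa(3) by (auto simp: orthogonal_def inner_commute)
  moreover from this have "a \<notin> A" using span_base by blast
  ultimately show ?case
    using A pa \<open>finite A\<close>
    by (intro exI[of _ "insert a A"]) (auto simp: independent_insert)
qed

section \<open>Unit spheres with infinitely many common points\<close>

text \<open>A dimension count made rigorous. The vectors \<open>x\<close> with \<open>N (x + b) = 1\<close> for all \<open>b \<in> B\<close>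
  solve \<open>d - 1\<close> equations in \<open>d\<close> unknowns. If \<open>B\<close> consists of unit vectors at which
  \<^term>\<open>N\<close> has independent gradients, then \<open>x = 0\<close> is a solution at which the equations are differentiable
  and independent. The norm need not be continuously differentiable near these points, so the implicit
  function theorem does not apply, but the open mapping theorem for maps that are continuous and have a surjective
  derivative at one point (a consequence of Brouwer's theorem) does.\<close>

lemma infinitely_many_common_translates:
  fixes N :: "'a::euclidean_space \<Rightarrow> real"
  assumes N: "is_norm N"
  obtains B where "finite B" "card B = DIM('a) - 1" "infinite {x. \<forall>b\<in>B. N (x + b) = 1}"
proof -
  obtain A where A: "independent A" "card A = DIM('a)"
    "\<forall>a\<in>A. \<exists>p. N p = 1 \<and> (N has_derivative (\<lambda>h. a \<bullet> h)) (at p)"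
    using independent_smooth_family[OF N order_refl] by blast
  have "finite A" using A(1) by (rule independent_imp_finite)
  obtain p where p: "\<And>a. a \<in> A \<Longrightarrow> N (p a) = 1"
    "\<And>a. a \<in> A \<Longrightarrow> (N has_derivative (\<lambda>h. a \<bullet> h)) (at (p a))"
    using A(3) by metis
  have inj: "inj_on p A"
  proof (rule inj_onI)
    fix a b assume ab: "a \<in> A" "b \<in> A" "p a = p b"
    then have "(\<lambda>h. a \<bullet> h) = (\<lambda>h. b \<bullet> h)"
      using p(2)[of a] p(2)[of b] has_derivative_unique by metis
    then show "a = b" by (metis inner_commute vector_eq_ldot)
  qed
  obtain a0 where a0: "a0 \<in> A" using A(2) DIM_positive[where 'a='a] by fastforce
  \<comment> \<open>The coordinate at \<open>a0\<close> is a free parameter that separates the solutions; the others are the equations.\<close>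
  define F where "F x = (\<Sum>a\<in>A - {a0}. (N (x + p a) - 1) *\<^sub>R a) + (a0 \<bullet> x) *\<^sub>R a0" for x
  define F' where "F' h = (\<Sum>a\<in>A - {a0}. (a \<bullet> h) *\<^sub>R a) + (a0 \<bullet> h) *\<^sub>R a0" for h
  have F'_alt: "F' h = (\<Sum>a\<in>A. (a \<bullet> h) *\<^sub>R a)" for h
    using a0 \<open>finite A\<close> by (simp add: F'_def sum.remove[of A a0] add.commute)
  have F0: "F 0 = 0" by (simp add: F_def p)
  have cont: "continuous_on UNIV F"
    unfolding F_def
    by (intro continuous_intros continuous_on_compose2[OF continuous_on_is_norm[OF N, of UNIV]]) auto
  have shift: "((\<lambda>x. N (x + p a)) has_derivative (\<lambda>h. a \<bullet> h)) (at 0)" if "a \<in> A" for a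
  proof -
    have "((\<lambda>x. x + p a) has_derivative (\<lambda>h. h)) (at 0)"
      by (auto intro!: derivative_eq_intros)
    then show ?thesis
      using has_derivative_compose[of "\<lambda>x. x + p a" "\<lambda>h. h" 0 UNIV N "\<lambda>h. a \<bullet> h"] p(2)[OF that]
      by simp
  qed
  have deriv: "(F has_derivative F') (at 0)"
    unfolding F_def F'_def
    by (auto intro!: derivative_eq_intros shift)
  have lin: "linear F'"
    using deriv by (rule has_derivative_linear)
  have "inj F'"
    unfolding linear_injective_0[OF lin]
  proof (intro allI impI)
    fix h assume "F' h = 0"
    moreover have "F' h \<bullet> h = (\<Sum>a\<in>A. (a \<bullet> h) * (a \<bullet> h))"
      unfolding F'_alt by (simp add: inner_sum_left)
    ultimately have "(\<Sum>a\<in>A. (a \<bullet> h) * (a \<bullet> h)) = 0" by simp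
    then have *: "\<forall>a\<in>A. a \<bullet> h = 0"
      using \<open>finite A\<close> by (simp add: sum_nonneg_eq_0_iff)
    have "span A = UNIV"
      using A(1,2) by (metis card_ge_dim_independent dim_UNIV dim_subset_UNIV order_refl top.extremum_uniqueI subset_UNIV)
    then have "orthogonal h h"
      using * orthogonal_to_span[of h A h] by (auto simp: orthogonal_def inner_commute)
    then show "h = 0" by (simp add: orthogonal_self)
  qed
  then obtain G where "linear G" "\<And>x. F' (G x) = x"
    using linear_injective_isomorphism[OF lin] by blast
  then have "0 \<in> interior (range F)"
    using sussmann_open_mapping[OF open_UNIV cont UNIV_I deriv, of G UNIV] F0
    by (auto simp: linear_conv_bounded_linear fun_eq_iff)
  then obtain e where e: "0 < e" "ball 0 e \<subseteq> range F"
    unfolding mem_interior by blast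
  have a0_nz: "a0 \<noteq> 0" using a0 A(1) dependent_zero by blast
  define B where "B = p ` (A - {a0})"
  \<comment> \<open>For each value \<open>t\<close> of the free parameter there is a solution, since \<open>t *\<^sub>R a0\<close> is near \<open>0 = F 0\<close>.\<close>
  define T where "T = {0<..<e / norm a0}"
  have sol: "t \<in> (\<lambda>x. a0 \<bullet> x) ` {x. \<forall>b\<in>B. N (x + b) = 1}" if t: "t \<in> T" for t
  proof -
    have "t *\<^sub>R a0 \<in> ball 0 e"
      using t a0_nz by (simp add: T_def field_simps)
    then obtain x where x: "F x = t *\<^sub>R a0" using e(2) by (metis imageE subsetD)
    define g where "g a = (if a = a0 then a0 \<bullet> x - t else N (x + p a) - 1)" for a
    have "(\<Sum>a\<in>A. g a *\<^sub>R a) = (\<Sum>a\<in>A - {a0}. g a *\<^sub>R a) + g a0 *\<^sub>R a0"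
      using a0 \<open>finite A\<close> by (simp add: sum.remove[of A a0] add.commute)
    also have "(\<Sum>a\<in>A - {a0}. g a *\<^sub>R a) = (\<Sum>a\<in>A - {a0}. (N (x + p a) - 1) *\<^sub>R a)"
      by (intro sum.cong) (auto simp: g_def)
    finally have "(\<Sum>a\<in>A. g a *\<^sub>R a) = 0"
      using x by (simp add: F_def g_def algebra_simps)
    then have g: "g a = 0" if "a \<in> A" for a
      using independentD[OF A(1) \<open>finite A\<close> subset_refl] that by blast
    have "a0 \<bullet> x = t" using g[OF a0] by (simp add: g_def)
    moreover have "N (x + p a) = 1" if "a \<in> A - {a0}" for a
      using g[of a] that by (simp add: g_def)
    then have "\<forall>b\<in>B. N (x + b) = 1" by (simp add: B_def)
    ultimately show ?thesis by blast
  qed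
  show ?thesis
  proof
    show "finite B" using \<open>finite A\<close> by (simp add: B_def)
    have "inj_on p (A - {a0})" using inj by (rule inj_on_subset) auto
    then show "card B = DIM('a) - 1"
      using a0 \<open>finite A\<close> A(2) by (simp add: B_def card_image)
    have "infinite T"
      unfolding T_def using e(1) a0_nz by (intro infinite_Ioo) simp
    moreover have "T \<subseteq> (\<lambda>x. a0 \<bullet> x) ` {x. \<forall>b\<in>B. N (x + b) = 1}"
      using sol by (rule subsetI)
    ultimately show "infinite {x. \<forall>b\<in>B. N (x + b) = 1}"
      by (meson finite_imageI finite_subset)
  qed
qed

section \<open>Almost invariant finite sets\<close>

text \<open>The sums of elements of \<open>B\<close> with coefficients at most \<open>m\<close> form sets of polynomial size in \<open>m\<close>, so
  some step from \<open>m\<close> to \<open>m + 1\<close> enlarges the set by a factor of at most \<open>1 + \<delta>\<close>. Translation by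
  an element of \<open>B\<close> stays inside the enlarged set. Coincidences among the sums only make the sets smaller.\<close>

lemma exists_almost_invariant_set:
  fixes B :: "'a::real_vector set" and \<delta> :: real
  assumes "finite B" "0 < \<delta>"
  obtains A where "finite A" "A \<noteq> {}"
    "\<And>b. b \<in> B \<Longrightarrow> (1 - \<delta>) * real (card A) \<le> real (card {a \<in> A. a + b \<in> A})"
proof -
  define S where "S m = (\<lambda>c. \<Sum>b\<in>B. real (c b) *\<^sub>R b) ` (B \<rightarrow>\<^sub>E {..m::nat})" for m
  have fin: "finite (S m)" for m
    using \<open>finite B\<close> by (auto simp: S_def intro: finite_PiE)
  have ne: "S m \<noteq> {}" for m by (auto simp: S_def PiE_eq_empty_iff)
  have poly: "card (S m) \<le> (Suc m) ^ card B" for m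
  proof -
    have "card (S m) \<le> card (B \<rightarrow>\<^sub>E {..m})"
      unfolding S_def using \<open>finite B\<close> by (intro card_image_le finite_PiE) auto
    then show ?thesis using \<open>finite B\<close> by (simp add: card_PiE)
  qed
  have mono: "S m \<subseteq> S (Suc m)" for m
    unfolding S_def by (intro image_mono PiE_mono) auto
  have step: "x + b \<in> S (Suc m)" if x: "x \<in> S m" and b: "b \<in> B" for x b m
  proof -
    obtain c where c: "c \<in> B \<rightarrow>\<^sub>E {..m}" "x = (\<Sum>b\<in>B. real (c b) *\<^sub>R b)"
      using x by (auto simp: S_def)
    define c' where "c' = c(b := Suc (c b))"
    have "c' \<in> B \<rightarrow>\<^sub>E {..Suc m}"
      using c(1) b by (auto simp: c'_def PiE_iff extensional_def intro: le_SucI)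
    moreover have "(\<Sum>b\<in>B. real (c' b) *\<^sub>R b) = x + b"
    proof -
      have "(\<Sum>b'\<in>B - {b}. real (c' b') *\<^sub>R b') = (\<Sum>b'\<in>B - {b}. real (c b') *\<^sub>R b')"
        by (intro sum.cong) (auto simp: c'_def)
      then show ?thesis
        using b \<open>finite B\<close> c(2)
        by (simp add: sum.remove[of B b] c'_def algebra_simps)
    qed
    ultimately show ?thesis by (auto simp: S_def intro!: image_eqI[of _ _ c'])
  qed
  have "\<exists>m. real (card (S (Suc m))) \<le> (1 + \<delta>) * real (card (S m))"
  proof (rule ccontr)
    assume "\<not> ?thesis"
    then have grow: "(1 + \<delta>) * real (card (S m)) \<le> real (card (S (Suc m)))" for m
      by (meson linear)
    have exp: "(1 + \<delta>) ^ m \<le> real (card (S m))" for m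
    proof (induction m)
      case 0
      have "card (S 0) \<noteq> 0" using fin ne by auto
      then show ?case by simp
    next
      case (Suc m)
      then have "(1 + \<delta>) * (1 + \<delta>) ^ m \<le> (1 + \<delta>) * real (card (S m))"
        using \<open>0 < \<delta>\<close> by (intro mult_left_mono) auto
      then show ?case using grow[of m] by simp
    qed
    have bound: "(1 + \<delta>) ^ m \<le> real (Suc m) ^ card B" for m
    proof -
      have "real (card (S m)) \<le> real (Suc m ^ card B)" using poly by (rule of_nat_mono)
      with exp[of m] show ?thesis by simp
    qed
    have "(\<lambda>m. real (Suc m) ^ card B / (1 + \<delta>) ^ m) \<longlonglongrightarrow> 0"
      using \<open>0 < \<delta>\<close> by real_asymp
    then have "\<forall>\<^sub>F m in sequentially. real (Suc m) ^ card B / (1 + \<delta>) ^ m < 1"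
      by (rule order_tendstoD) simp
    then obtain m where "real (Suc m) ^ card B / (1 + \<delta>) ^ m < 1"
      using eventually_happens'[OF sequentially_bot] by blast
    moreover have "0 < (1 + \<delta>) ^ m" using \<open>0 < \<delta>\<close> by simp
    ultimately show False using bound[of m] by (simp add: divide_less_eq_1_pos)
  qed
  then obtain m where m: "real (card (S (Suc m))) \<le> (1 + \<delta>) * real (card (S m))" by blast
  show ?thesis
  proof
    show "finite (S m)" "S m \<noteq> {}" by (fact fin ne)+
    fix b assume b: "b \<in> B"
    let ?T = "(\<lambda>a. a + b) ` S m"
    have "card (S m) + card ?T = card (S m \<union> ?T) + card (S m \<inter> ?T)"
      using fin by (intro card_Un_Int) auto
    moreover have "card ?T = card (S m)" by (simp add: card_image)
    moreover have "card (S m \<union> ?T) \<le> card (S (Suc m))"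
      using fin mono step[OF _ b] by (intro card_mono) auto
    moreover have "S m \<inter> ?T = (\<lambda>a. a + b) ` {a \<in> S m. a + b \<in> S m}" by auto
    then have "card (S m \<inter> ?T) = card {a \<in> S m. a + b \<in> S m}" by (simp add: card_image)
    ultimately have "2 * card (S m) \<le> card (S (Suc m)) + card {a \<in> S m. a + b \<in> S m}"
      by linarith
    then have "2 * real (card (S m)) \<le> real (card (S (Suc m))) + real (card {a \<in> S m. a + b \<in> S m})"
      by linarith
    then show "(1 - \<delta>) * real (card (S m)) \<le> real (card {a \<in> S m. a + b \<in> S m})"
      using m by (simp add: algebra_simps)
  qed
qed

section \<open>Unit distances under translation and doubling\<close>

lemma finite_unit_pairs: "finite P \<Longrightarrow> finite (unit_pairs N P)"
  by (rule finite_subset[of _ "Pow P"]) (auto simp: unit_pairs_def)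

lemma unit_pairs_mono: "P \<subseteq> Q \<Longrightarrow> unit_pairs N P \<subseteq> unit_pairs N Q"
  by (auto simp: unit_pairs_def)

lemma unit_pairs_translate: "unit_pairs N ((\<lambda>x. x + v) ` P) = (\<lambda>e. (\<lambda>x. x + v) ` e) ` unit_pairs N P"
proof (intro equalityI subsetI)
  fix e assume "e \<in> unit_pairs N ((\<lambda>x. x + v) ` P)"
  then obtain x y where "x \<in> P" "y \<in> P" "x \<noteq> y" "N (x - y) = 1" "e = {x + v, y + v}"
    by (auto simp: unit_pairs_def)
  then have "{x, y} \<in> unit_pairs N P" "e = (\<lambda>x. x + v) ` {x, y}"
    by (auto simp: unit_pairs_def)
  then show "e \<in> (\<lambda>e. (\<lambda>x. x + v) ` e) ` unit_pairs N P" by blast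
next
  fix e assume "e \<in> (\<lambda>e. (\<lambda>x. x + v) ` e) ` unit_pairs N P"
  then obtain x y where xy: "x \<in> P" "y \<in> P" "x \<noteq> y" "N (x - y) = 1" "e = {x + v, y + v}"
    by (auto simp: unit_pairs_def)
  then have "N (x + v - (y + v)) = 1" "x + v \<noteq> y + v" by simp_all
  with xy show "e \<in> unit_pairs N ((\<lambda>x. x + v) ` P)"
    unfolding unit_pairs_def by blast
qed

lemma card_unit_pairs_translate: "card (unit_pairs N ((\<lambda>x. x + v) ` P)) = card (unit_pairs N P)"
  unfolding unit_pairs_translate
  by (intro card_image inj_on_subset[OF inj_on_image[of _ UNIV]]) (auto intro: inj_onI)

lemma card_unit_pairs_disjoint_union:
  assumes "finite P" "finite Q" "P \<inter> Q = {}"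
  shows "card (unit_pairs N P) + card (unit_pairs N Q) \<le> card (unit_pairs N (P \<union> Q))"
proof -
  have "unit_pairs N P \<inter> unit_pairs N Q = {}"
    using assms(3) by (auto simp: unit_pairs_def doubleton_eq_iff)
  then have "card (unit_pairs N P) + card (unit_pairs N Q) = card (unit_pairs N P \<union> unit_pairs N Q)"
    using assms by (simp add: card_Un_disjoint finite_unit_pairs)
  also have "\<dots> \<le> card (unit_pairs N (P \<union> Q))"
    using assms by (intro card_mono finite_unit_pairs) (auto simp: unit_pairs_def)
  finally show ?thesis .
qed

lemma disjoint_translate_exists:
  fixes P Q :: "'a::ab_group_add set"
  assumes "finite P" "finite Q" "infinite E"
  obtains v where "v \<in> E" "P \<inter> (\<lambda>x. x + v) ` Q = {}"
proof -
  have "finite ((\<lambda>(x, y). x - y) ` (P \<times> Q))" using assms by simp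
  then obtain v where v: "v \<in> E" "v \<notin> (\<lambda>(x, y). x - y) ` (P \<times> Q)"
    using \<open>infinite E\<close> by (meson finite_subset subsetI)
  have "P \<inter> (\<lambda>x. x + v) ` Q = {}"
  proof (rule ccontr)
    assume "\<not> ?thesis"
    then obtain y where "y \<in> Q" "y + v \<in> P" by auto
    then have "(y + v) - y \<in> (\<lambda>(x, y). x - y) ` (P \<times> Q)" by (intro image_eqI[of _ _ "(y + v, y)"]) auto
    then show False using v(2) by simp
  qed
  with v(1) show ?thesis by (rule that)
qed

text \<open>If \<open>a\<close> and \<open>a + b\<close> both lie in \<open>A\<close>, then \<open>a\<close> and the shifted point \<open>a + b + v\<close> are at
  distance 1. These pairs have one point in each half of the new set, so they are new, and distinct
  \<open>(a, b)\<close> give distinct pairs.\<close>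

lemma doubling_step:
  fixes N :: "'a::real_vector \<Rightarrow> real"
  assumes "finite A" "finite B"
    and disj: "A \<inter> (\<lambda>x. x + v) ` A = {}"
    and unit: "\<And>b. b \<in> B \<Longrightarrow> N (v + b) = 1"
  shows "2 * card (unit_pairs N A) + (\<Sum>b\<in>B. card {a \<in> A. a + b \<in> A})
           \<le> card (unit_pairs N (A \<union> (\<lambda>x. x + v) ` A))"
proof -
  let ?A' = "(\<lambda>x. x + v) ` A"
  define f where "f = (\<lambda>(b, a). {a, a + b + v})"
  define X where "X = (SIGMA b:B. {a \<in> A. a + b \<in> A})"
  have "inj_on f X"
  proof (rule inj_onI, clarsimp simp: X_def f_def)
    fix b a b' a'
    assume A: "a \<in> A" "a + b \<in> A" "a' \<in> A" "a' + b' \<in> A" and eq: "{a, a + b + v} = {a', a' + b' + v}"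
    have "a \<noteq> a' + b' + v" using disj A by (auto simp: disjoint_iff)
    then show "b = b' \<and> a = a'" using eq by (auto simp: doubleton_eq_iff)
  qed
  then have card_X: "card (f ` X) = (\<Sum>b\<in>B. card {a \<in> A. a + b \<in> A})"
    using assms(1,2) by (simp add: card_image X_def)
  have mixed: "f ` X \<inter> (unit_pairs N A \<union> unit_pairs N ?A') = {}"
  proof -
    have "\<not> f z \<subseteq> A \<and> \<not> f z \<subseteq> ?A'" if "z \<in> X" for z
      using that disj by (auto simp: f_def X_def disjoint_iff)
    moreover have "e \<subseteq> P" if "e \<in> unit_pairs N P" for e P
      using that by (auto simp: unit_pairs_def)
    ultimately show ?thesis by blast
  qed
  have sub: "f ` X \<subseteq> unit_pairs N (A \<union> ?A')"
  proof
    fix e assume "e \<in> f ` X"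
    then obtain b a where ba: "b \<in> B" "a \<in> A" "a + b \<in> A" "e = {a + b + v, a}"
      by (auto simp: f_def X_def insert_commute)
    moreover have "a + b + v \<noteq> a"
      using disj ba by (metis disjoint_iff image_eqI)
    moreover have "N (a + b + v - a) = 1"
      using unit[OF ba(1)] by (simp add: add.commute)
    ultimately show "e \<in> unit_pairs N (A \<union> ?A')"
      unfolding unit_pairs_def by blast
  qed
  have "2 * card (unit_pairs N A) + card (f ` X)
      = card (unit_pairs N A \<union> unit_pairs N ?A') + card (f ` X)"
  proof -
    have "unit_pairs N A \<inter> unit_pairs N ?A' = {}"
      using disj by (auto simp: unit_pairs_def doubleton_eq_iff)
    then show ?thesis
      using assms(1) by (simp add: card_Un_disjoint finite_unit_pairs card_unit_pairs_translate)
  qed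
  also have "\<dots> = card ((unit_pairs N A \<union> unit_pairs N ?A') \<union> f ` X)"
    using mixed assms(1,2)
    by (intro card_Un_disjoint[symmetric]) (auto simp: finite_unit_pairs X_def)
  also have "\<dots> \<le> card (unit_pairs N (A \<union> ?A'))"
    using sub assms(1) unit_pairs_mono[of A "A \<union> ?A'" N] unit_pairs_mono[of ?A' "A \<union> ?A'" N]
    by (intro card_mono finite_unit_pairs) auto
  finally show ?thesis by (simp add: card_X)
qed

text \<open>Each doubling adds about \<open>\<kappa> * card B\<close> unit pairs per old point, which makes \<open>\<kappa> * card B / 2\<close> per point
  of the doubled set. The almost invariance under \<open>B\<close> passes to the doubled set, so the gain is the
  same in every step. An infinite supply of vectors \<open>v\<close> is enough to keep the two halves disjoint, since
  only finitely many \<open>v\<close> are differences of points constructed so far.\<close>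

lemma iterated_doubling:
  fixes N :: "'a::real_vector \<Rightarrow> real" and \<kappa> :: real
  assumes "finite A" "finite B"
    and inf: "infinite {v. \<forall>b\<in>B. N (v + b) = 1}"
    and shifts: "\<And>b. b \<in> B \<Longrightarrow> \<kappa> * real (card A) \<le> real (card {a \<in> A. a + b \<in> A})"
  shows "\<exists>P. finite P \<and> card P = 2 ^ i * card A \<and>
           \<kappa> * real (card B) * real i / 2 * real (card P) \<le> real (card (unit_pairs N P))"
proof -
  have "\<exists>P. finite P \<and> card P = 2 ^ i * card A \<and>
           \<kappa> * real (card B) * real i / 2 * real (card P) \<le> real (card (unit_pairs N P)) \<and>
           (\<forall>b\<in>B. \<kappa> * real (card P) \<le> real (card {a \<in> P. a + b \<in> P}))"
  proof (induction i)
    case 0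
    show ?case using \<open>finite A\<close> shifts by (intro exI[of _ A]) auto
  next
    case (Suc i)
    then obtain P where P: "finite P" "card P = 2 ^ i * card A"
      "\<kappa> * real (card B) * real i / 2 * real (card P) \<le> real (card (unit_pairs N P))"
      "\<And>b. b \<in> B \<Longrightarrow> \<kappa> * real (card P) \<le> real (card {a \<in> P. a + b \<in> P})" by blast
    obtain v where v: "\<forall>b\<in>B. N (v + b) = 1" and disj: "P \<inter> (\<lambda>x. x + v) ` P = {}"
      by (rule disjoint_translate_exists[OF P(1) P(1) inf]) blast
    define Q where "Q = P \<union> (\<lambda>x. x + v) ` P"
    have "finite Q" using P(1) by (simp add: Q_def)
    have card_Q: "card Q = 2 * card P"
      using P(1) disj by (simp add: Q_def card_Un_disjoint card_image)
    have "real (card B) * (\<kappa> * real (card P)) \<le> (\<Sum>b\<in>B. real (card {a \<in> P. a + b \<in> P}))"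
      using sum_bounded_below[of B "\<kappa> * real (card P)"] P(4) by simp
    moreover have "2 * real (card (unit_pairs N P)) + (\<Sum>b\<in>B. real (card {a \<in> P. a + b \<in> P}))
        \<le> real (card (unit_pairs N Q))"
      using of_nat_mono[OF doubling_step[OF P(1) \<open>finite B\<close> disj, folded Q_def], where 'a=real] v by simp
    ultimately have "\<kappa> * real (card B) * real (Suc i) / 2 * real (card Q) \<le> real (card (unit_pairs N Q))"
      using P(3) by (simp add: card_Q algebra_simps)
    moreover have "\<kappa> * real (card Q) \<le> real (card {a \<in> Q. a + b \<in> Q})" if b: "b \<in> B" for b
    proof -
      let ?R = "{a \<in> P. a + b \<in> P}"
      have "?R \<union> (\<lambda>x. x + v) ` ?R \<subseteq> {a \<in> Q. a + b \<in> Q}"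
        by (auto simp: Q_def algebra_simps image_iff)
      then have "card (?R \<union> (\<lambda>x. x + v) ` ?R) \<le> card {a \<in> Q. a + b \<in> Q}"
        using \<open>finite Q\<close> by (intro card_mono) auto
      moreover have "card (?R \<union> (\<lambda>x. x + v) ` ?R) = 2 * card ?R"
      proof -
        have "?R \<inter> (\<lambda>x. x + v) ` ?R = {}" using disj by auto
        then show ?thesis using P(1) by (simp add: card_Un_disjoint card_image)
      qed
      ultimately have "2 * real (card ?R) \<le> real (card {a \<in> Q. a + b \<in> Q})" by linarith
      then show ?thesis using P(4)[OF b] by (simp add: card_Q)
    qed
    ultimately show ?case
      using \<open>finite Q\<close> card_Q P(2) by (intro exI[of _ Q]) auto
  qed
  then show ?thesis by blast
qed

text \<open>Sizes between those that doubling produces are filled up with disjoint translates and \<open>r\<close> arbitrary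
  further points.\<close>

lemma many_disjoint_translates:
  fixes N :: "'a::real_vector \<Rightarrow> real"
  assumes inf: "infinite (UNIV :: 'a set)" and "finite P"
  shows "\<exists>Q. finite Q \<and> card Q = q * card P + r \<and> q * card (unit_pairs N P) \<le> card (unit_pairs N Q)"
proof -
  have "\<exists>Q. finite Q \<and> card Q = q * card P \<and> q * card (unit_pairs N P) \<le> card (unit_pairs N Q)"
  proof (induction q)
    case 0
    show ?case by (intro exI[of _ "{}"]) auto
  next
    case (Suc q)
    then obtain Q where Q: "finite Q" "card Q = q * card P"
      "q * card (unit_pairs N P) \<le> card (unit_pairs N Q)" by blast
    obtain v where disj: "Q \<inter> (\<lambda>x. x + v) ` P = {}"
      by (rule disjoint_translate_exists[OF Q(1) \<open>finite P\<close> inf])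
    show ?case
      using Q \<open>finite P\<close> disj card_unit_pairs_disjoint_union[OF Q(1) _ disj, of N]
      by (intro exI[of _ "Q \<union> (\<lambda>x. x + v) ` P"])
         (auto simp: card_Un_disjoint card_image card_unit_pairs_translate)
  qed
  then obtain Q where Q: "finite Q" "card Q = q * card P"
    "q * card (unit_pairs N P) \<le> card (unit_pairs N Q)" by blast
  have "infinite (UNIV - Q)" using inf Q(1) by simp
  then obtain R where R: "R \<subseteq> UNIV - Q" "finite R" "card R = r"
    using infinite_arbitrarily_large by metis
  have "card (unit_pairs N Q) \<le> card (unit_pairs N (Q \<union> R))"
    using Q R by (intro card_mono finite_unit_pairs unit_pairs_mono) auto
  moreover have "card (Q \<union> R) = q * card P + r"
    using Q R by (subst card_Un_disjoint) auto
  ultimately show ?thesis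
    using Q R by (intro exI[of _ "Q \<union> R"]) auto
qed

section \<open>Asymptotics\<close>

text \<open>Almost all of the \<open>n\<close> points form translates of one set of \<open>2 ^ i * m\<close> points, where \<open>m\<close> is the size of the almost
  invariant set and \<open>2 ^ i * m\<close> is at most \<open>\<delta> * n\<close>. A factor \<open>1 - \<delta>\<close> is lost to
  the points left over, another one to the almost invariance, and \<open>log 2 n - i\<close> stays bounded.\<close>

lemma many_unit_distances:
  fixes N :: "'a::euclidean_space \<Rightarrow> real"
  assumes N: "is_norm N" and \<epsilon>: "0 < \<epsilon>"
  defines "D \<equiv> real DIM('a) - 1"
  shows "\<exists>n0. \<forall>n\<ge>n0. \<exists>P. finite P \<and> card P = n \<and>
           (D - \<epsilon>) / 2 * (real n * log 2 (real n)) \<le> real (card (unit_pairs N P))"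
proof -
  have D: "0 \<le> D" by (simp add: D_def Suc_leI)
  obtain B :: "'a set" where B: "finite B" "card B = DIM('a) - 1"
    and inf: "infinite {v. \<forall>b\<in>B. N (v + b) = 1}"
    by (rule infinitely_many_common_translates[OF N])
  have infinite_space: "infinite (UNIV :: 'a set)"
    using inf by (rule infinite_super[OF subset_UNIV])
  have card_B: "real (card B) = D" by (simp add: B(2) D_def of_nat_diff Suc_leI)
  define \<delta> where "\<delta> = min (1/2) (\<epsilon> / (4 * (D + 1)))"
  have \<delta>: "0 < \<delta>" "\<delta> < 1" using \<epsilon> D by (auto simp: \<delta>_def)
  define E where "E = (1 - \<delta>) * ((1 - \<delta>) * D)"
  have E: "0 \<le> E" "D - \<epsilon> / 2 \<le> E"
  proof -
    show "0 \<le> E" using \<delta> D by (simp add: E_def)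
    have "2 * \<delta> * D \<le> 2 * (\<epsilon> / (4 * (D + 1))) * (D + 1)"
      using \<epsilon> D by (intro mult_mono) (auto simp: \<delta>_def)
    also have "\<dots> = \<epsilon> / 2" using D by (simp add: field_simps)
    finally have "2 * \<delta> * D \<le> \<epsilon> / 2" .
    moreover have "E = D - 2 * \<delta> * D + \<delta> * \<delta> * D" by (simp add: E_def algebra_simps)
    moreover have "0 \<le> \<delta> * \<delta> * D" using \<delta> D by simp
    ultimately show "D - \<epsilon> / 2 \<le> E" by linarith
  qed
  obtain A where A: "finite A" "A \<noteq> {}"
    "\<And>b. b \<in> B \<Longrightarrow> (1 - \<delta>) * real (card A) \<le> real (card {a \<in> A. a + b \<in> A})"
    using exists_almost_invariant_set[OF B(1) \<delta>(1)] by blast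
  define m where "m = card A"
  have m: "0 < m" using A by (simp add: m_def card_gt_0_iff)
  \<comment> \<open>\<open>C\<close> bounds the gap between \<open>log 2 n\<close> and the number of doublings that are possible within \<open>\<delta> * n\<close> points.\<close>
  define C where "C = 1 - log 2 (\<delta> / real m)"
  have "\<forall>\<^sub>F n in sequentially. real m / \<delta> \<le> real n \<and> E * C / (\<epsilon> / 2) \<le> log 2 (real n)"
    by (intro eventually_conj; real_asymp)
  then obtain n0 where n0: "\<And>n. n \<ge> n0 \<Longrightarrow> real m / \<delta> \<le> real n \<and> E * C / (\<epsilon> / 2) \<le> log 2 (real n)"
    by (auto simp: eventually_sequentially)
  show ?thesis
  proof (intro exI[of _ n0] allI impI)
    fix n assume "n0 \<le> n"
    define L where "L = log 2 (real n)"
    have mn: "1 \<le> real n * \<delta> / real m" and EC: "E * C \<le> \<epsilon> / 2 * L"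
      using n0[OF \<open>n0 \<le> n\<close>] \<delta> m \<epsilon> by (auto simp: field_simps L_def)
    then have n: "0 < n" by (cases n) auto
    define i where "i = nat \<lfloor>log 2 (real n * \<delta> / real m)\<rfloor>"
    have log0: "0 \<le> log 2 (real n * \<delta> / real m)" using mn by simp
    have i_le: "real i \<le> log 2 (real n * \<delta> / real m)"
      using log0 by (simp add: i_def)
    have "log 2 (real n * \<delta> / real m) - 1 \<le> real i"
      using log0 unfolding i_def by linarith
    moreover have "log 2 (real n * (\<delta> / real m)) = L + log 2 (\<delta> / real m)"
      using n m \<delta> unfolding L_def by (intro log_mult_pos) auto
    ultimately have i_ge: "L - C \<le> real i" by (simp add: C_def)
    have "2 ^ i = 2 powr real i" by (simp add: powr_realpow)
    also have "\<dots> \<le> real n * \<delta> / real m"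
      using i_le mn by (simp add: le_log_iff)
    finally have size: "2 ^ i * real m \<le> \<delta> * real n"
      using m by (simp add: field_simps)
    obtain P where P: "finite P" "card P = 2 ^ i * m"
      and edges: "(1 - \<delta>) * D * real i / 2 * real (card P) \<le> real (card (unit_pairs N P))"
      using iterated_doubling[OF A(1) B(1) inf A(3), of i] unfolding card_B m_def by blast
    obtain Q where Q: "finite Q" "card Q = (n div card P) * card P + n mod card P"
      and edges_Q: "(n div card P) * card (unit_pairs N P) \<le> card (unit_pairs N Q)"
      using many_disjoint_translates[OF infinite_space P(1), of "n div card P" "n mod card P" N]
      by blast
    have covered: "(1 - \<delta>) * real n \<le> real (n div card P) * real (card P)"
    proof -
      have "n mod card P \<le> card P" using P m by (intro less_imp_le mod_less_divisor) simp
      then have "real (n mod card P) \<le> real (card P)" by (rule of_nat_mono)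
      then have "real (n mod card P) \<le> \<delta> * real n" using size by (simp add: P(2))
      moreover have "real n = real (n div card P) * real (card P) + real (n mod card P)"
        by (metis div_mult_mod_eq of_nat_add of_nat_mult)
      ultimately show ?thesis by (simp add: algebra_simps)
    qed
    have "(D - \<epsilon>) * L \<le> E * (L - C)"
    proof -
      have "(D - \<epsilon> / 2) * L \<le> E * L"
        using E n by (intro mult_right_mono) (auto simp: L_def)
      then show ?thesis using EC by (simp add: algebra_simps)
    qed
    also have "\<dots> \<le> E * real i" using E(1) i_ge by (intro mult_left_mono)
    finally have "(D - \<epsilon>) * L / 2 * real n \<le> E * real i / 2 * real n"
      by (intro mult_right_mono divide_right_mono) auto
    also have "\<dots> = (1 - \<delta>) * D * real i / 2 * ((1 - \<delta>) * real n)"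
      by (simp add: E_def)
    also have "\<dots> \<le> (1 - \<delta>) * D * real i / 2 * (real (n div card P) * real (card P))"
      using covered D \<delta> by (intro mult_left_mono) auto
    also have "\<dots> = real (n div card P) * ((1 - \<delta>) * D * real i / 2 * real (card P))"
      by simp
    also have "\<dots> \<le> real (n div card P) * real (card (unit_pairs N P))"
      using edges by (intro mult_left_mono) auto
    also have "\<dots> \<le> real (card (unit_pairs N Q))"
      using of_nat_mono[OF edges_Q, where 'a=real] by simp
    finally have "(D - \<epsilon>) / 2 * (real n * log 2 (real n)) \<le> real (card (unit_pairs N Q))"
      by (simp add: L_def mult_ac)
    then show "\<exists>P. finite P \<and> card P = n \<and>
        (D - \<epsilon>) / 2 * (real n * log 2 (real n)) \<le> real (card (unit_pairs N P))"
      using Q by (intro exI[of _ Q]) simp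
  qed
qed

lemma max_unit_distances_ge:
  assumes "finite P" "card P = n"
  shows "card (unit_pairs N P) \<le> max_unit_distances N n"
  unfolding max_unit_distances_def using assms
  by (intro Max_ge finite_unit_pair_counts) blast

theorem theorem1p2:
  fixes N :: "real ^ 'd \<Rightarrow> real"
  assumes "CARD('d) \<ge> 2"
    and "is_norm N"
  shows "(\<exists>e :: nat \<Rightarrow> real. e \<longlonglongrightarrow> 0 \<and>
            (\<forall>n\<ge>1. real (max_unit_distances N n)
                    \<ge> (real CARD('d) - 1 - e n) / 2 * (real n * log 2 (real n)))) \<and>
         (\<forall>\<epsilon>::real. \<epsilon> > 0 \<longrightarrow> (\<exists>n0::nat. \<forall>n\<ge>n0. \<exists>P :: (real ^ 'd) set. finite P \<and> card P = n \<and>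
            real (card (unit_pairs N P))
              \<ge> (real CARD('d) - 1 - \<epsilon>) / 2 * (real n * log 2 (real n))))"
proof (intro conjI allI impI)
  define D where "D = real CARD('d) - 1"
  have sets: "\<exists>n0. \<forall>n\<ge>n0. \<exists>P. finite P \<and> card P = n \<and>
      (D - \<epsilon>) / 2 * (real n * log 2 (real n)) \<le> real (card (unit_pairs N P))" if "0 < \<epsilon>" for \<epsilon>
    using many_unit_distances[OF assms(2) that] by (simp add: D_def)
  show "\<exists>n0. \<forall>n\<ge>n0. \<exists>P :: (real ^ 'd) set. finite P \<and> card P = n \<and>
      real (card (unit_pairs N P)) \<ge> (real CARD('d) - 1 - \<epsilon>) / 2 * (real n * log 2 (real n))"
    if "0 < \<epsilon>" for \<epsilon> :: real
    using sets[OF that] by (simp add: D_def)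
  define U where "U n = real (max_unit_distances N n)" for n
  \<comment> \<open>For \<open>n = 1\<close> the quotient is 0 by convention; the bound holds there because the logarithm vanishes.\<close>
  define e where "e n = max 0 (D - 2 * U n / (real n * log 2 (real n)))" for n
  have "e \<longlonglongrightarrow> 0"
  proof (rule LIMSEQ_I)
    fix r :: real assume r: "0 < r"
    obtain n0 where n0: "\<And>n. n \<ge> n0 \<Longrightarrow> \<exists>P. finite P \<and> card P = n \<and>
        (D - r / 2) / 2 * (real n * log 2 (real n)) \<le> real (card (unit_pairs N P))"
      using sets[of "r / 2"] r by auto
    have "norm (e n - 0) < r" if n: "n \<ge> max n0 2" for n
    proof -
      have pos: "0 < real n * log 2 (real n)" using n by auto
      obtain P where P: "finite P" "card P = n"
        "(D - r / 2) / 2 * (real n * log 2 (real n)) \<le> real (card (unit_pairs N P))"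
        using n0[of n] n by auto
      have "real (card (unit_pairs N P)) \<le> U n"
        using max_unit_distances_ge[OF P(1,2), of N] by (simp add: U_def)
      with P(3) have "(D - r / 2) * (real n * log 2 (real n)) \<le> 2 * U n" by simp
      then have "D - r / 2 \<le> 2 * U n / (real n * log 2 (real n))"
        using pos by (simp add: pos_le_divide_eq)
      then show ?thesis using r by (simp add: e_def)
    qed
    then show "\<exists>no. \<forall>n\<ge>no. norm (e n - 0) < r" by blast
  qed
  moreover have "(D - e n) / 2 * (real n * log 2 (real n)) \<le> U n" if "n \<ge> 1" for n
  proof (cases "n = 1")
    case False
    then have pos: "0 < real n * log 2 (real n)" using that by auto
    have "D - e n \<le> 2 * U n / (real n * log 2 (real n))" by (simp add: e_def)
    then have "(D - e n) * (real n * log 2 (real n)) \<le> 2 * U n"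
      using pos by (simp add: pos_le_divide_eq)
    then show ?thesis by simp
  qed (simp add: U_def)
  ultimately show "\<exists>e :: nat \<Rightarrow> real. e \<longlonglongrightarrow> 0 \<and> (\<forall>n\<ge>1. real (max_unit_distances N n)
      \<ge> (real CARD('d) - 1 - e n) / 2 * (real n * log 2 (real n)))"
    by (auto simp: D_def U_def)
qed

end
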